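(* Let $G\colon\mathbf{Set}\to\mathbf{Set}$ be a functor, $\gamma\colon X\to GX$ a $G$-coalgebra, $M=(M_n)_{n\in\mathbb{N}}$ an $(\mathbb{N},+,0)$-graded monad on $\mathbf{Set}$, and $\alpha\colon G\to M_1$ a natural transformation (i.e. $(M,\alpha)$ is a graded semantics for $G$). Then $(\gamma,\alpha)$ extends uniquely to a graded coalgebra $(\gamma_n\colon X\to G^nX)_{n\in\mathbb{N}}$ for the $(\mathbb{N},+,0)$-graded monad $(G^n)_{n\in\mathbb{N}}$ together with a graded monad morphism $(\alpha^n\colon G^n\to M_n)_{n\in\mathbb{N}}$; that is, there are a unique such graded coalgebra with $\gamma_1=\gamma$ and a unique such graded monad morphism with $\alpha^1=\alpha$.
   Context: A monad $M$ graded by a monoid $(T,\cdot,e)$ consists of endofunctors $M_t$ ($t\in T$), natural transformations $\mu^{s,t}\colon M_sM_t\to M_{s\cdot t}$ and $\eta\colon\mathrm{Id}\to M_e$ such that $\mu^{r,s\cdot t}\circ M_r\mu^{s,t}=\mu^{r\cdot s,t}\circ\mu^{r,s}M_t$ and $\mu^{t,e}\circ M_t\eta=\mathrm{id}=\mu^{e,t}\circ\eta M_t$. The graded monad $(G^n)_{n\in\mathbb{N}}$ has as multiplications and unit the identities $G^mG^n=G^{m+n}$ and $\mathrm{Id}=G^0$. A graded coalgebra of $M$ is an object $X$ with morphisms $\gamma_t\colon X\to M_tX$ such that $\gamma_e=\eta_X$ and $\gamma_{s\cdot t}=\mu^{s,t}_X\circ M_s\gamma_t\circ\gamma_s$. A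 graded monad morphism $\alpha\colon M\to N$ between $T$-graded monads is a family of natural transformations $\alpha^t\colon M_t\to N_t$ with $\alpha^{s\cdot t}\circ\mu^{s,t}=\mu^{s,t}\circ(\alpha^s\star\alpha^t)$ and $\alpha^e\circ\eta=\eta$, where $\star$ is the horizontal composition of natural transformations. *)

theory Defs
  imports Main "HOL-Library.FuncSet"
begin

record ('o, 'm) category =
  Ob :: "'o set"
  Hom :: "'o \<Rightarrow> 'o \<Rightarrow> 'm set"
  Id :: "'o \<Rightarrow> 'm"
  Comp :: "'m \<Rightarrow> 'm \<Rightarrow> 'm"  (infixl "\<cdot>\<index>" 70)

text \<open>Only objects in \<open>Ob C\<close> and arrows between them matter. Arrows know their domain and codomain
  (last clause), so that the action of a functor on arrows need not be indexed by objects.\<close>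

definition is_category :: "('o, 'm) category \<Rightarrow> bool" where
  "is_category C \<longleftrightarrow>
     (\<forall>A\<in>Ob C. Id C A \<in> Hom C A A) \<and>
     (\<forall>A\<in>Ob C. \<forall>B\<in>Ob C. \<forall>D\<in>Ob C. \<forall>f\<in>Hom C A B. \<forall>g\<in>Hom C B D. g \<cdot>\<^bsub>C\<^esub> f \<in> Hom C A D) \<and>
     (\<forall>A\<in>Ob C. \<forall>B\<in>Ob C. \<forall>f\<in>Hom C A B. f \<cdot>\<^bsub>C\<^esub> Id C A = f \<and> Id C B \<cdot>\<^bsub>C\<^esub> f = f) \<and>
     (\<forall>A\<in>Ob C. \<forall>B\<in>Ob C. \<forall>D\<in>Ob C. \<forall>E\<in>Ob C. \<forall>f\<in>Hom C A B. \<forall>g\<in>Hom C B D. \<forall>h\<in>Hom C D E.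
        h \<cdot>\<^bsub>C\<^esub> (g \<cdot>\<^bsub>C\<^esub> f) = (h \<cdot>\<^bsub>C\<^esub> g) \<cdot>\<^bsub>C\<^esub> f) \<and>
     (\<forall>A\<in>Ob C. \<forall>B\<in>Ob C. \<forall>A'\<in>Ob C. \<forall>B'\<in>Ob C.
        Hom C A B \<inter> Hom C A' B' \<noteq> {} \<longrightarrow> A = A' \<and> B = B')"


subsection \<open>The category of sets\<close>

text \<open>HOL has no type of all sets. As in foundations based on universes, the category of sets is
  relative to a collection \<open>U\<close> of sets, the small sets: its objects are the members of \<open>U\<close>, its
  arrows are all functions between them. No closure property of \<open>U\<close> is imposed; the usual
  category of sets is obtained when \<open>'u\<close> is a model of set theory and \<open>U\<close> consists of the
  extensions of its elements. The function underlying an arrow is \<open>undefined\<close> outside the domain,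
  so that arrows are equal iff they agree as functions.\<close>

datatype 'u set_arrow = Arrow (src: "'u set") (app: "'u \<Rightarrow> 'u") (tgt: "'u set")

definition set_cat :: "'u set set \<Rightarrow> ('u set, 'u set_arrow) category" where
  "set_cat U =
     \<lparr>Ob = U,
      Hom = (\<lambda>A B. {f. src f = A \<and> tgt f = B \<and> app f \<in> A \<rightarrow>\<^sub>E B}),
      Id = (\<lambda>A. Arrow A (\<lambda>x\<in>A. x) A),
      Comp = (\<lambda>g f. Arrow (src f) (compose (src f) (app g) (app f)) (tgt g))\<rparr>"

lemma is_category_set_cat: "is_category (set_cat U)"
  unfolding is_category_def set_cat_def
  by (auto simp: compose_def PiE_iff extensional_def fun_eq_iff set_arrow.expand)


subsection \<open>Endofunctors and natural transformations\<close>

record ('o, 'm) endofun =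
  omap :: "'o \<Rightarrow> 'o"
  amap :: "'m \<Rightarrow> 'm"

definition endofunctor :: "('o, 'm) category \<Rightarrow> ('o, 'm) endofun \<Rightarrow> bool" where
  "endofunctor C F \<longleftrightarrow>
     (\<forall>A\<in>Ob C. omap F A \<in> Ob C) \<and>
     (\<forall>A\<in>Ob C. \<forall>B\<in>Ob C. \<forall>f\<in>Hom C A B. amap F f \<in> Hom C (omap F A) (omap F B)) \<and>
     (\<forall>A\<in>Ob C. amap F (Id C A) = Id C (omap F A)) \<and>
     (\<forall>A\<in>Ob C. \<forall>B\<in>Ob C. \<forall>D\<in>Ob C. \<forall>f\<in>Hom C A B. \<forall>g\<in>Hom C B D.
        amap F (g \<cdot>\<^bsub>C\<^esub> f) = amap F g \<cdot>\<^bsub>C\<^esub> amap F f)"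

definition id_fun :: "('o, 'm) endofun" where
  "id_fun = \<lparr>omap = (\<lambda>A. A), amap = (\<lambda>f. f)\<rparr>"

definition comp_fun :: "('o, 'm) endofun \<Rightarrow> ('o, 'm) endofun \<Rightarrow> ('o, 'm) endofun" where
  "comp_fun F H = \<lparr>omap = omap F \<circ> omap H, amap = amap F \<circ> amap H\<rparr>"

primrec pow_fun :: "('o, 'm) endofun \<Rightarrow> nat \<Rightarrow> ('o, 'm) endofun" where
  "pow_fun G 0 = id_fun"
| "pow_fun G (Suc n) = comp_fun G (pow_fun G n)"

text \<open>A natural transformation is a family indexed by the objects of \<open>C\<close>, encoded as a function
  that is \<open>undefined\<close> elsewhere, so that equality of such functions is equality of families.\<close>

definition nat_trans ::
  "('o, 'm) category \<Rightarrow> ('o, 'm) endofun \<Rightarrow> ('o, 'm) endofun \<Rightarrow> ('o \<Rightarrow> 'm) \<Rightarrow> bool" where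
  "nat_trans C F H \<alpha> \<longleftrightarrow>
     \<alpha> \<in> extensional (Ob C) \<and>
     (\<forall>A\<in>Ob C. \<alpha> A \<in> Hom C (omap F A) (omap H A)) \<and>
     (\<forall>A\<in>Ob C. \<forall>B\<in>Ob C. \<forall>f\<in>Hom C A B. \<alpha> B \<cdot>\<^bsub>C\<^esub> amap F f = amap H f \<cdot>\<^bsub>C\<^esub> \<alpha> A)"

text \<open>The horizontal composite \<open>\<alpha> \<star> \<beta> : F F' \<rightarrow> H H'\<close> of \<open>\<alpha> : F \<rightarrow> H\<close> and \<open>\<beta> : F' \<rightarrow> H'\<close>; it depends
  on the source \<open>F\<close> of \<open>\<alpha>\<close> and on the target \<open>H'\<close> of \<open>\<beta>\<close>.\<close>

definition hcomp ::
  "('o, 'm) category \<Rightarrow> ('o, 'm) endofun \<Rightarrow> ('o, 'm) endofun \<Rightarrow>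
     ('o \<Rightarrow> 'm) \<Rightarrow> ('o \<Rightarrow> 'm) \<Rightarrow> 'o \<Rightarrow> 'm" where
  "hcomp C F H' \<alpha> \<beta> = (\<lambda>A\<in>Ob C. \<alpha> (omap H' A) \<cdot>\<^bsub>C\<^esub> amap F (\<beta> A))"


subsection \<open>Graded monads, their coalgebras and morphisms\<close>

text \<open>The grading monoid is a type of class \<open>monoid_add\<close>; for \<open>nat\<close> this is the additive monoid
  of natural numbers.\<close>

record ('t, 'o, 'm) gmonad =
  gfun :: "'t \<Rightarrow> ('o, 'm) endofun"
  gmult :: "'t \<Rightarrow> 't \<Rightarrow> 'o \<Rightarrow> 'm"
  gunit :: "'o \<Rightarrow> 'm"

definition graded_monad ::
  "('o, 'm) category \<Rightarrow> ('t::monoid_add, 'o, 'm) gmonad \<Rightarrow> bool" where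
  "graded_monad C M \<longleftrightarrow>
     (\<forall>t. endofunctor C (gfun M t)) \<and>
     (\<forall>s t. nat_trans C (comp_fun (gfun M s) (gfun M t)) (gfun M (s + t)) (gmult M s t)) \<and>
     nat_trans C id_fun (gfun M 0) (gunit M) \<and>
     (\<forall>r s t. \<forall>A\<in>Ob C.
        gmult M r (s + t) A \<cdot>\<^bsub>C\<^esub> amap (gfun M r) (gmult M s t A) =
        gmult M (r + s) t A \<cdot>\<^bsub>C\<^esub> gmult M r s (omap (gfun M t) A)) \<and>
     (\<forall>t. \<forall>A\<in>Ob C.
        gmult M t 0 A \<cdot>\<^bsub>C\<^esub> amap (gfun M t) (gunit M A) = Id C (omap (gfun M t) A) \<and>
        gmult M 0 t A \<cdot>\<^bsub>C\<^esub> gunit M (omap (gfun M t) A) = Id C (omap (gfun M t) A))"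

definition pow_gmonad :: "('o, 'm) category \<Rightarrow> ('o, 'm) endofun \<Rightarrow> (nat, 'o, 'm) gmonad" where
  "pow_gmonad C G =
     \<lparr>gfun = pow_fun G,
      gmult = (\<lambda>m n. \<lambda>A\<in>Ob C. Id C (omap (pow_fun G (m + n)) A)),
      gunit = (\<lambda>A\<in>Ob C. Id C A)\<rparr>"

definition graded_coalgebra ::
  "('o, 'm) category \<Rightarrow> ('t::monoid_add, 'o, 'm) gmonad \<Rightarrow> 'o \<Rightarrow> ('t \<Rightarrow> 'm) \<Rightarrow> bool" where
  "graded_coalgebra C M X \<gamma> \<longleftrightarrow>
     graded_monad C M \<and> X \<in> Ob C \<and>
     (\<forall>t. \<gamma> t \<in> Hom C X (omap (gfun M t) X)) \<and>
     \<gamma> 0 = gunit M X \<and>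
     (\<forall>s t. \<gamma> (s + t) = gmult M s t X \<cdot>\<^bsub>C\<^esub> amap (gfun M s) (\<gamma> t) \<cdot>\<^bsub>C\<^esub> \<gamma> s)"

definition gmonad_morphism ::
  "('o, 'm) category \<Rightarrow> ('t::monoid_add, 'o, 'm) gmonad \<Rightarrow> ('t, 'o, 'm) gmonad \<Rightarrow>
     ('t \<Rightarrow> 'o \<Rightarrow> 'm) \<Rightarrow> bool" where
  "gmonad_morphism C M N \<alpha> \<longleftrightarrow>
     graded_monad C M \<and> graded_monad C N \<and>
     (\<forall>t. nat_trans C (gfun M t) (gfun N t) (\<alpha> t)) \<and>
     (\<forall>s t. \<forall>A\<in>Ob C.
        \<alpha> (s + t) A \<cdot>\<^bsub>C\<^esub> gmult M s t A =
        gmult N s t A \<cdot>\<^bsub>C\<^esub> hcomp C (gfun M s) (gfun N t) (\<alpha> s) (\<alpha> t) A) \<and>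
     (\<forall>A\<in>Ob C. \<alpha> 0 A \<cdot>\<^bsub>C\<^esub> gunit M A = gunit N A)"

definition coalgebra :: "('o, 'm) category \<Rightarrow> ('o, 'm) endofun \<Rightarrow> 'o \<Rightarrow> 'm \<Rightarrow> bool" where
  "coalgebra C G X \<gamma> \<longleftrightarrow> X \<in> Ob C \<and> \<gamma> \<in> Hom C X (omap G X)"

end

theory Submission
  imports Defs
begin

text \<open>All multiplications of \<open>(G\<^sup>n)\<close> being identities, the laws for the pairs \<open>(1, n)\<close> force
  \<open>\<gamma>\<^sub>n\<^sub>+\<^sub>1 = G \<gamma>\<^sub>n \<cdot> \<gamma>\<close> and \<open>\<alpha>\<^sup>n\<^sup>+\<^sup>1 = \<mu>\<^sup>1\<^sup>,\<^sup>n \<cdot> (\<alpha> \<star> \<alpha>\<^sup>n)\<close>, while the unit laws force \<open>\<gamma>\<^sub>0 = id\<close> and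
  \<open>\<alpha>\<^sup>0 = \<eta>\<close>. Conversely, the families so defined satisfy the laws for all pairs \<open>(m, n)\<close> by
  induction on \<open>m\<close>; in the case of \<open>\<alpha>\<close> the step is associativity of \<open>\<mu>\<close> together with naturality
  of \<open>\<alpha>\<close>. The argument works in every category.\<close>

section \<open>Strict composition and powers of endofunctors\<close>

lemma comp_fun_assoc: "comp_fun (comp_fun F H) K = comp_fun F (comp_fun H K)"
  by (simp add: comp_fun_def comp_assoc)

lemma comp_fun_id [simp]: "comp_fun id_fun F = F" "comp_fun F id_fun = F"
  by (simp_all add: comp_fun_def id_fun_def comp_def)

lemma omap_comp_fun [simp]: "omap (comp_fun F H) A = omap F (omap H A)"
  by (simp add: comp_fun_def)

lemma amap_comp_fun [simp]: "amap (comp_fun F H) f = amap F (amap H f)"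
  by (simp add: comp_fun_def)

lemma omap_id_fun [simp]: "omap id_fun A = A"
  by (simp add: id_fun_def)

lemma amap_id_fun [simp]: "amap id_fun f = f"
  by (simp add: id_fun_def)

text \<open>Endofunctors compose as HOL functions, hence strictly associatively, so this is an
  equation and not merely an isomorphism. It is what lets identities serve as multiplications of
  (G^n).\<close>

lemma pow_fun_add: "pow_fun G (m + n) = comp_fun (pow_fun G m) (pow_fun G n)"
  by (induction m) (simp_all add: comp_fun_assoc)

section \<open>Categories, functors and natural transformations\<close>

locale cat =
  fixes C :: "('o, 'm) category" (structure)
  assumes is_category: "is_category C"
begin

lemma id_in_hom: "A \<in> Ob C \<Longrightarrow> Id C A \<in> Hom C A A"
  using is_category by (simp add: is_category_def)

lemma comp_in_hom:
  "\<lbrakk>A \<in> Ob C; B \<in> Ob C; D \<in> Ob C; f \<in> Hom C A B; g \<in> Hom C B D\<rbrakk> \<Longrightarrow> g \<cdot> f \<in> Hom C A D"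
  using is_category unfolding is_category_def by blast

lemma comp_id:
  "\<lbrakk>A \<in> Ob C; B \<in> Ob C; f \<in> Hom C A B\<rbrakk> \<Longrightarrow> f \<cdot> Id C A = f"
  using is_category unfolding is_category_def by blast

lemma id_comp:
  "\<lbrakk>A \<in> Ob C; B \<in> Ob C; f \<in> Hom C A B\<rbrakk> \<Longrightarrow> Id C B \<cdot> f = f"
  using is_category unfolding is_category_def by blast

text \<open>The objects occur only in the premises, so uses must supply them. The long
  \<open>OF\<close> chains below are typing derivations for the three arrows.\<close>

lemma assoc:
  "\<lbrakk>A \<in> Ob C; B \<in> Ob C; D \<in> Ob C; E \<in> Ob C; f \<in> Hom C A B; g \<in> Hom C B D; h \<in> Hom C D E\<rbrakk>
    \<Longrightarrow> h \<cdot> (g \<cdot> f) = (h \<cdot> g) \<cdot> f"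
  using is_category unfolding is_category_def by blast

lemma omap_in_Ob: "endofunctor C F \<Longrightarrow> A \<in> Ob C \<Longrightarrow> omap F A \<in> Ob C"
  by (simp add: endofunctor_def)

lemma amap_in_hom:
  "\<lbrakk>endofunctor C F; A \<in> Ob C; B \<in> Ob C; f \<in> Hom C A B\<rbrakk>
    \<Longrightarrow> amap F f \<in> Hom C (omap F A) (omap F B)"
  by (simp add: endofunctor_def)

lemma amap_id: "endofunctor C F \<Longrightarrow> A \<in> Ob C \<Longrightarrow> amap F (Id C A) = Id C (omap F A)"
  by (simp add: endofunctor_def)

lemma amap_comp:
  "\<lbrakk>endofunctor C F; A \<in> Ob C; B \<in> Ob C; D \<in> Ob C; f \<in> Hom C A B; g \<in> Hom C B D\<rbrakk>
    \<Longrightarrow> amap F (g \<cdot> f) = amap F g \<cdot> amap F f"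
  unfolding endofunctor_def by blast

lemma nat_trans_in_hom:
  "\<lbrakk>nat_trans C F H \<alpha>; A \<in> Ob C\<rbrakk> \<Longrightarrow> \<alpha> A \<in> Hom C (omap F A) (omap H A)"
  by (simp add: nat_trans_def)

lemma naturality:
  "\<lbrakk>nat_trans C F H \<alpha>; A \<in> Ob C; B \<in> Ob C; f \<in> Hom C A B\<rbrakk>
    \<Longrightarrow> \<alpha> B \<cdot> amap F f = amap H f \<cdot> \<alpha> A"
  by (simp add: nat_trans_def)

lemma nat_trans_extensional: "nat_trans C F H \<alpha> \<Longrightarrow> \<alpha> \<in> extensional (Ob C)"
  by (simp add: nat_trans_def)

lemma endofunctor_comp_fun:
  assumes F: "endofunctor C F" and H: "endofunctor C H"
  shows "endofunctor C (comp_fun F H)"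
  unfolding endofunctor_def
proof (intro conjI ballI)
  fix A B D f g
  assume Ob: "A \<in> Ob C" "B \<in> Ob C" "D \<in> Ob C" and f: "f \<in> Hom C A B" and g: "g \<in> Hom C B D"
  show "amap (comp_fun F H) (g \<cdot> f) = amap (comp_fun F H) g \<cdot> amap (comp_fun F H) f"
    using amap_comp[OF H Ob f g]
      amap_comp[OF F omap_in_Ob[OF H Ob(1)] omap_in_Ob[OF H Ob(2)] omap_in_Ob[OF H Ob(3)]
        amap_in_hom[OF H Ob(1,2) f] amap_in_hom[OF H Ob(2,3) g]]
    by simp
qed (use F H in \<open>simp_all add: omap_in_Ob amap_in_hom amap_id\<close>)

lemma endofunctor_pow_fun: "endofunctor C G \<Longrightarrow> endofunctor C (pow_fun G n)"
proof (induction n)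
  case 0
  show ?case by (simp add: endofunctor_def)
qed (simp add: endofunctor_comp_fun)

text \<open>The multiplications and the unit of (G^n) have this form.\<close>

lemma nat_trans_id:
  assumes "endofunctor C F"
  shows "nat_trans C F F (\<lambda>A\<in>Ob C. Id C (omap F A))"
  unfolding nat_trans_def
proof (intro conjI ballI)
  fix A B f assume "A \<in> Ob C" "B \<in> Ob C" "f \<in> Hom C A B"
  with assms amap_in_hom[OF assms this]
  show "(\<lambda>A\<in>Ob C. Id C (omap F A)) B \<cdot> amap F f = amap F f \<cdot> (\<lambda>A\<in>Ob C. Id C (omap F A)) A"
    by (simp add: id_comp[of "omap F A" "omap F B"] comp_id[of "omap F A" "omap F B"] omap_in_Ob)
qed (use assms in \<open>simp_all add: omap_in_Ob id_in_hom\<close>)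

lemma nat_trans_vcomp:
  assumes F: "endofunctor C F" and H: "endofunctor C H" and K: "endofunctor C K"
    and \<alpha>: "nat_trans C F H \<alpha>" and \<beta>: "nat_trans C H K \<beta>"
  shows "nat_trans C F K (\<lambda>A\<in>Ob C. \<beta> A \<cdot> \<alpha> A)"
  unfolding nat_trans_def
proof (intro conjI ballI)
  fix A assume "A \<in> Ob C"
  then show "(\<lambda>A\<in>Ob C. \<beta> A \<cdot> \<alpha> A) A \<in> Hom C (omap F A) (omap K A)"
    using comp_in_hom[OF _ _ _ nat_trans_in_hom[OF \<alpha>] nat_trans_in_hom[OF \<beta>]] F H K
    by (simp add: omap_in_Ob)
next
  fix A B f assume Ob: "A \<in> Ob C" "B \<in> Ob C" and f: "f \<in> Hom C A B"
  note ob = Ob[THEN omap_in_Ob[OF F]] Ob[THEN omap_in_Ob[OF H]] Ob[THEN omap_in_Ob[OF K]]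
  have "(\<beta> B \<cdot> \<alpha> B) \<cdot> amap F f = \<beta> B \<cdot> (\<alpha> B \<cdot> amap F f)"
    by (intro assoc[symmetric, OF ob(1,2,4,6)] amap_in_hom[OF F] nat_trans_in_hom[OF \<alpha>]
        nat_trans_in_hom[OF \<beta>] Ob f)
  also have "\<dots> = \<beta> B \<cdot> (amap H f \<cdot> \<alpha> A)"
    by (simp add: naturality[OF \<alpha> Ob f])
  also have "\<dots> = (\<beta> B \<cdot> amap H f) \<cdot> \<alpha> A"
    by (intro assoc[OF ob(1,3,4,6)] amap_in_hom[OF H] nat_trans_in_hom[OF \<alpha>]
        nat_trans_in_hom[OF \<beta>] Ob f)
  also have "\<dots> = (amap K f \<cdot> \<beta> A) \<cdot> \<alpha> A"
    by (simp add: naturality[OF \<beta> Ob f])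
  also have "\<dots> = amap K f \<cdot> (\<beta> A \<cdot> \<alpha> A)"
    by (intro assoc[symmetric, OF ob(1,3,5,6)] amap_in_hom[OF K] nat_trans_in_hom[OF \<alpha>]
        nat_trans_in_hom[OF \<beta>] Ob f)
  finally show "(\<lambda>A\<in>Ob C. \<beta> A \<cdot> \<alpha> A) B \<cdot> amap F f = amap K f \<cdot> (\<lambda>A\<in>Ob C. \<beta> A \<cdot> \<alpha> A) A"
    using Ob by simp
qed simp

text \<open>The horizontal composite is the vertical composite of the whiskerings F\<beta> : FF' ->
  FH' and \<alpha>H' : FH' -> HH', so it suffices that both of these are natural.\<close>

lemma nat_trans_hcomp:
  assumes F: "endofunctor C F" and F': "endofunctor C F'"
    and H: "endofunctor C H" and H': "endofunctor C H'"
    and \<alpha>: "nat_trans C F H \<alpha>" and \<beta>: "nat_trans C F' H' \<beta>"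
  shows "nat_trans C (comp_fun F F') (comp_fun H H') (hcomp C F H' \<alpha> \<beta>)"
proof -
  have "nat_trans C (comp_fun F F') (comp_fun F H') (\<lambda>A\<in>Ob C. amap F (\<beta> A))"
    unfolding nat_trans_def
  proof (intro conjI ballI)
    fix A assume "A \<in> Ob C"
    then show "(\<lambda>A\<in>Ob C. amap F (\<beta> A)) A \<in> Hom C (omap (comp_fun F F') A) (omap (comp_fun F H') A)"
      using F F' H' \<beta> by (simp add: amap_in_hom nat_trans_in_hom omap_in_Ob)
  next
    fix A B f assume Ob: "A \<in> Ob C" "B \<in> Ob C" and f: "f \<in> Hom C A B"
    note ob = Ob[THEN omap_in_Ob[OF F']] Ob[THEN omap_in_Ob[OF H']]
    \<comment> \<open>The naturality square of F\<beta> is the image under F of that of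
      \<beta>.\<close>
    have "amap F (\<beta> B) \<cdot> amap F (amap F' f) = amap F (\<beta> B \<cdot> amap F' f)"
      by (intro amap_comp[symmetric, OF F ob(1,2,4)] amap_in_hom[OF F'] nat_trans_in_hom[OF \<beta>] Ob f)
    also have "\<dots> = amap F (amap H' f \<cdot> \<beta> A)"
      by (simp add: naturality[OF \<beta> Ob f])
    also have "\<dots> = amap F (amap H' f) \<cdot> amap F (\<beta> A)"
      by (intro amap_comp[OF F ob(1,3,4)] amap_in_hom[OF H'] nat_trans_in_hom[OF \<beta>] Ob f)
    finally show "(\<lambda>A\<in>Ob C. amap F (\<beta> A)) B \<cdot> amap (comp_fun F F') f =
        amap (comp_fun F H') f \<cdot> (\<lambda>A\<in>Ob C. amap F (\<beta> A)) A"
      using Ob by simp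
  qed simp
  \<comment> \<open>Naturality of \<alpha>H' at f is naturality of \<alpha> at
    \<open>amap H' f\<close>.\<close>
  moreover have "nat_trans C (comp_fun F H') (comp_fun H H') (\<lambda>A\<in>Ob C. \<alpha> (omap H' A))"
    using H' \<alpha> unfolding nat_trans_def by (simp add: omap_in_Ob amap_in_hom)
  ultimately have "nat_trans C (comp_fun F F') (comp_fun H H')
      (\<lambda>A\<in>Ob C. (\<lambda>A\<in>Ob C. \<alpha> (omap H' A)) A \<cdot> (\<lambda>A\<in>Ob C. amap F (\<beta> A)) A)"
    by (rule nat_trans_vcomp[rotated 3]) (intro endofunctor_comp_fun assms)+
  also have "(\<lambda>A\<in>Ob C. (\<lambda>A\<in>Ob C. \<alpha> (omap H' A)) A \<cdot> (\<lambda>A\<in>Ob C. amap F (\<beta> A)) A)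
      = hcomp C F H' \<alpha> \<beta>"
    by (simp add: hcomp_def fun_eq_iff)
  finally show ?thesis .
qed

section \<open>The graded monad of powers and its coalgebras\<close>

text \<open>Since G^m preserves identities and G^m G^n = G^(m+n), each associativity and unit law
  reduces to id \<cdot> id = id.\<close>

lemma graded_monad_pow_gmonad:
  assumes "endofunctor C G"
  shows "graded_monad C (pow_gmonad C G)"
proof -
  note fn = endofunctor_pow_fun[OF assms]
  have "nat_trans C (comp_fun (pow_fun G m) (pow_fun G n)) (pow_fun G (m + n))
      (\<lambda>A\<in>Ob C. Id C (omap (pow_fun G (m + n)) A))" for m n
    using nat_trans_id[OF fn[of "m + n"]] by (simp add: pow_fun_add)
  moreover have "nat_trans C id_fun id_fun (\<lambda>A\<in>Ob C. Id C A)"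
    using nat_trans_id[OF fn[of 0]] by simp
  moreover have "Id C (omap (pow_fun G n) A) \<cdot> Id C (omap (pow_fun G n) A)
      = Id C (omap (pow_fun G n) A)" if "A \<in> Ob C" for n A
    using that by (simp add: comp_id[OF _ _ id_in_hom] omap_in_Ob[OF fn])
  ultimately show ?thesis
    unfolding graded_monad_def
    by (simp add: pow_gmonad_def fn omap_in_Ob[OF fn] amap_id[OF fn] pow_fun_add comp_fun_assoc)
qed

lemma graded_coalgebra_pow_gmonad_iff:
  assumes G: "endofunctor C G" and X: "X \<in> Ob C"
  shows "graded_coalgebra C (pow_gmonad C G) X \<gamma> \<longleftrightarrow>
    (\<forall>n. \<gamma> n \<in> Hom C X (omap (pow_fun G n) X)) \<and> \<gamma> 0 = Id C X \<and>
    (\<forall>m n. \<gamma> (m + n) = amap (pow_fun G m) (\<gamma> n) \<cdot> \<gamma> m)"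
proof -
  note fn = endofunctor_pow_fun[OF G]
  \<comment> \<open>The composite in the coalgebra law is bracketed to the left, so the identity
    multiplication cancels against G^m \<gamma>_n directly.\<close>
  have "Id C (omap (pow_fun G (m + n)) X) \<cdot> amap (pow_fun G m) (\<gamma> n) = amap (pow_fun G m) (\<gamma> n)"
    if "\<forall>n. \<gamma> n \<in> Hom C X (omap (pow_fun G n) X)" for m n
    by (rule id_comp[of "omap (pow_fun G m) X"])
      (use that in \<open>simp_all add: omap_in_Ob[OF fn] X pow_fun_add amap_in_hom[OF fn]\<close>)
  then show ?thesis
    using X graded_monad_pow_gmonad[OF G]
    unfolding graded_coalgebra_def by (auto simp: pow_gmonad_def)
qed

text \<open>The n-step unfolding X -> GX -> ... -> G^n X of the coalgebra. Reading the law at (1, n)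
  rather than (n, 1) matches the recursion of \<open>pow_fun\<close>.\<close>

primrec pow_coalg :: "('o, 'm) endofun \<Rightarrow> 'o \<Rightarrow> 'm \<Rightarrow> nat \<Rightarrow> 'm" where
  "pow_coalg G X \<gamma> 0 = Id C X"
| "pow_coalg G X \<gamma> (Suc n) = amap G (pow_coalg G X \<gamma> n) \<cdot> \<gamma>"

theorem ex1_graded_coalgebra:
  assumes G: "endofunctor C G" and "coalgebra C G X \<gamma>"
  shows "\<exists>!\<gamma>'. graded_coalgebra C (pow_gmonad C G) X \<gamma>' \<and> \<gamma>' 1 = \<gamma>"
proof (rule ex1I)
  let ?\<gamma> = "pow_coalg G X \<gamma>"
  note fn = endofunctor_pow_fun[OF G]
  have X: "X \<in> Ob C" and \<gamma>: "\<gamma> \<in> Hom C X (omap G X)"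
    using assms(2) by (simp_all add: coalgebra_def)
  note GX = omap_in_Ob[OF G X]
  have hom: "?\<gamma> n \<in> Hom C X (omap (pow_fun G n) X)" for n
  proof (induction n)
    case (Suc n)
    then show ?case
      using comp_in_hom[OF X GX _ \<gamma> amap_in_hom[OF G X _ Suc]]
      by (simp add: omap_in_Ob[OF G] omap_in_Ob[OF fn] X)
  qed (simp add: id_in_hom X)
  have "?\<gamma> (m + n) = amap (pow_fun G m) (?\<gamma> n) \<cdot> ?\<gamma> m" for m n
  proof (induction m)
    case 0
    show ?case
      using comp_id[OF X omap_in_Ob[OF fn X] hom] by simp
  next
    case (Suc m)
    let ?M = "omap (pow_fun G m) X" and ?N = "omap (pow_fun G m) (omap (pow_fun G n) X)"
    have M: "?M \<in> Ob C" and N: "?N \<in> Ob C"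
      by (simp_all add: omap_in_Ob[OF fn] X)
    have a: "amap (pow_fun G m) (?\<gamma> n) \<in> Hom C ?M ?N"
      by (rule amap_in_hom[OF fn X omap_in_Ob[OF fn X] hom])
    have "?\<gamma> (Suc m + n) = amap G (amap (pow_fun G m) (?\<gamma> n) \<cdot> ?\<gamma> m) \<cdot> \<gamma>"
      by (simp add: Suc)
    also have "\<dots> = (amap G (amap (pow_fun G m) (?\<gamma> n)) \<cdot> amap G (?\<gamma> m)) \<cdot> \<gamma>"
      by (simp add: amap_comp[OF G X M N hom a])
    \<comment> \<open>After regrouping, the right factor is \<open>?\<gamma> (Suc m)\<close> and the
      left one is \<open>pow_fun G (Suc m)\<close> applied to \<open>?\<gamma> n\<close>.\<close>
    also have "\<dots> = amap G (amap (pow_fun G m) (?\<gamma> n)) \<cdot> (amap G (?\<gamma> m) \<cdot> \<gamma>)"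
      by (rule assoc[symmetric, OF X GX omap_in_Ob[OF G M] omap_in_Ob[OF G N] \<gamma>
          amap_in_hom[OF G X M hom] amap_in_hom[OF G M N a]])
    finally show ?case by simp
  qed
  \<comment> \<open>Here \<gamma>_1 is G(id) \<cdot> \<gamma>, and G preserves identities.\<close>
  moreover have "?\<gamma> 1 = \<gamma>"
    by (simp add: amap_id[OF G X] id_comp[OF X GX \<gamma>])
  ultimately show "graded_coalgebra C (pow_gmonad C G) X ?\<gamma> \<and> ?\<gamma> 1 = \<gamma>"
    using hom by (simp add: graded_coalgebra_pow_gmonad_iff[OF G X])
  fix \<gamma>' assume "graded_coalgebra C (pow_gmonad C G) X \<gamma>' \<and> \<gamma>' 1 = \<gamma>"
  \<comment> \<open>The law at (1, n), with \<open>pow_fun G 1\<close> equal to G, is the recursion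
    of \<open>pow_coalg\<close>. The deleted simp rules keep the sum \<open>1 + n\<close> intact, so
    that the law still matches it.\<close>
  then have "\<gamma>' 0 = Id C X" "\<And>n. \<gamma>' (1 + n) = amap G (\<gamma>' n) \<cdot> \<gamma>"
    by (auto simp: graded_coalgebra_pow_gmonad_iff[OF G X] simp del: add_Suc plus_1_eq_Suc)
  then have "\<gamma>' n = ?\<gamma> n" for n
    by (induction n) simp_all
  then show "\<gamma>' = ?\<gamma>" ..
qed

section \<open>Graded monad morphisms out of the powers\<close>

lemma graded_monadD:
  assumes "graded_monad C M"
  shows "endofunctor C (gfun M t)"
    and "nat_trans C (comp_fun (gfun M s) (gfun M t)) (gfun M (s + t)) (gmult M s t)"
    and "nat_trans C id_fun (gfun M 0) (gunit M)"
    and "A \<in> Ob C \<Longrightarrow> gmult M r (s + t) A \<cdot> amap (gfun M r) (gmult M s t A) =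
      gmult M (r + s) t A \<cdot> gmult M r s (omap (gfun M t) A)"
    and "A \<in> Ob C \<Longrightarrow> gmult M t 0 A \<cdot> amap (gfun M t) (gunit M A) = Id C (omap (gfun M t) A)"
    and "A \<in> Ob C \<Longrightarrow> gmult M 0 t A \<cdot> gunit M (omap (gfun M t) A) = Id C (omap (gfun M t) A)"
  using assms unfolding graded_monad_def by blast+

text \<open>Identities on the side of (G^n) cancel once the components of \<alpha> are known to be
  arrows. What remains is a formula for \<open>\<alpha> (m + n)\<close> and the value of
  \<open>\<alpha> 0\<close>.\<close>

lemma gmonad_morphism_pow_gmonad_iff:
  assumes G: "endofunctor C G" and M: "graded_monad C M"
  shows "gmonad_morphism C (pow_gmonad C G) M \<alpha> \<longleftrightarrow>
    (\<forall>n. nat_trans C (pow_fun G n) (gfun M n) (\<alpha> n)) \<and> \<alpha> 0 = gunit M \<and>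
    (\<forall>m n. \<forall>A\<in>Ob C. \<alpha> (m + n) A =
      gmult M m n A \<cdot> hcomp C (pow_fun G m) (gfun M n) (\<alpha> m) (\<alpha> n) A)"
    (is "_ \<longleftrightarrow> ?nat \<and> _ \<and> _")
proof -
  note fn = endofunctor_pow_fun[OF G]
  have *: "\<alpha> n A \<cdot> Id C (omap (pow_fun G n) A) = \<alpha> n A" if ?nat "A \<in> Ob C" for n A
    by (rule comp_id[OF omap_in_Ob omap_in_Ob nat_trans_in_hom])
      (use that fn graded_monadD(1)[OF M] in blast)+
  \<comment> \<open>The unit law speaks of objects of C only; it becomes an equation of functions
    because both families are undefined elsewhere.\<close>
  have 0: "(\<forall>A\<in>Ob C. \<alpha> 0 A \<cdot> Id C A = gunit M A) \<longleftrightarrow> \<alpha> 0 = gunit M" if ?nat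
  proof -
    have "\<alpha> 0 \<in> extensional (Ob C)" "gunit M \<in> extensional (Ob C)"
      using that graded_monadD(3)[OF M] nat_trans_extensional by blast+
    then show ?thesis
      using *[OF that, of _ 0] by (auto intro: extensionalityI)
  qed
  show ?thesis
  proof (cases ?nat)
    case True
    then show ?thesis
      using graded_monad_pow_gmonad[OF G] M 0[OF True] *[OF True]
      by (simp add: gmonad_morphism_def pow_gmonad_def conj_commute)
  \<comment> \<open>Without naturality both sides of the equivalence are false.\<close>
  qed (auto simp: gmonad_morphism_def pow_gmonad_def)
qed

text \<open>The law at (1, n) with \<alpha> in place of \<alpha>^1. The restriction to
  \<open>Ob C\<close> makes each member a family in the sense of \<open>nat_trans\<close>, as
  uniqueness up to equality of functions demands.\<close>

primrec pow_morph ::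
  "('o, 'm) endofun \<Rightarrow> (nat, 'o, 'm) gmonad \<Rightarrow> ('o \<Rightarrow> 'm) \<Rightarrow> nat \<Rightarrow> 'o \<Rightarrow> 'm" where
  "pow_morph G M \<alpha> 0 = gunit M"
| "pow_morph G M \<alpha> (Suc n) =
     (\<lambda>A\<in>Ob C. gmult M 1 n A \<cdot> hcomp C G (gfun M n) \<alpha> (pow_morph G M \<alpha> n) A)"

theorem ex1_gmonad_morphism:
  assumes G: "endofunctor C G" and M: "graded_monad C M"
    and \<alpha>: "nat_trans C G (gfun M 1) \<alpha>"
  shows "\<exists>!\<alpha>'. gmonad_morphism C (pow_gmonad C G) M \<alpha>' \<and> \<alpha>' 1 = \<alpha>"
proof (rule ex1I)
  let ?\<alpha> = "pow_morph G M \<alpha>"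
  note fG = endofunctor_pow_fun[OF G] and fM = graded_monadD(1)[OF M]
  note mult = graded_monadD(2)[OF M] and unit = graded_monadD(3)[OF M]
  note ob = omap_in_Ob[OF G] omap_in_Ob[OF fG] omap_in_Ob[OF fM]
  have nat: "nat_trans C (pow_fun G n) (gfun M n) (?\<alpha> n)" for n
  proof (induction n)
    case (Suc n)
    show ?case
      \<comment> \<open>\<alpha>^(n+1) is \<alpha> \<star> \<alpha>^n followed by \<mu>^(1,n), whose
        target is M_(n+1).\<close>
      using nat_trans_vcomp[OF _ _ _ nat_trans_hcomp[OF G fG fM fM \<alpha> Suc] mult]
      by (simp add: endofunctor_comp_fun G fG fM del: restrict_apply)
  qed (simp add: unit)
  have mult_hom: "gmult M m n A \<in> Hom C (omap (gfun M m) (omap (gfun M n) A)) (omap (gfun M (m + n)) A)"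
    if "A \<in> Ob C" for m n A
    using nat_trans_in_hom[OF mult that] by simp
  have "?\<alpha> (m + n) A = gmult M m n A \<cdot> hcomp C (pow_fun G m) (gfun M n) (?\<alpha> m) (?\<alpha> n) A"
    if A: "A \<in> Ob C" for m n A
  proof (induction m)
    \<comment> \<open>As G^0 is the identity functor, the right-hand side is \<mu>^(0,n) \<cdot>
      \<eta> \<cdot> \<alpha>^n, and the left unit law of M applies.\<close>
    case 0
    let ?N = "omap (gfun M n) A"
    have u: "gunit M ?N \<in> Hom C ?N (omap (gfun M 0) ?N)"
      using nat_trans_in_hom[OF unit ob(3)[OF A]] by simp
    have "gmult M 0 n A \<in> Hom C (omap (gfun M 0) ?N) ?N"
      using mult_hom[OF A, of 0] by simp
    then have "gmult M 0 n A \<cdot> (gunit M ?N \<cdot> ?\<alpha> n A) = (gmult M 0 n A \<cdot> gunit M ?N) \<cdot> ?\<alpha> n A"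
      by (intro assoc[OF _ _ _ _ nat_trans_in_hom[OF nat A] u]) (simp_all add: ob A)
    also have "\<dots> = ?\<alpha> n A"
      using graded_monadD(6)[OF M A] id_comp[OF _ _ nat_trans_in_hom[OF nat A]]
      by (simp add: ob A)
    finally show ?case
      using A by (simp add: hcomp_def)
  next
    case (Suc m)
    let ?N = "omap (gfun M n) A"
    \<comment> \<open>The induction hypothesis factors \<alpha>^(m+n) at A as
      \<open>?\<mu> \<cdot> (?a \<cdot> ?b)\<close>, along \<open>?P\<close> -> \<open>?Q\<close> ->
      \<open>?R\<close> -> \<open>?S\<close>.\<close>
    let ?\<mu> = "gmult M m n A" and ?a = "?\<alpha> m ?N" and ?b = "amap (pow_fun G m) (?\<alpha> n A)"
    let ?P = "omap (pow_fun G m) (omap (pow_fun G n) A)" and ?Q = "omap (pow_fun G m) ?N"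
      and ?R = "omap (gfun M m) ?N" and ?S = "omap (gfun M (m + n)) A"
    have Ob: "?N \<in> Ob C" "?P \<in> Ob C" "?Q \<in> Ob C" "?R \<in> Ob C" "?S \<in> Ob C"
      by (simp_all add: ob A)
    have b: "?b \<in> Hom C ?P ?Q"
      by (intro amap_in_hom[OF fG] nat_trans_in_hom[OF nat] ob A)
    have a: "?a \<in> Hom C ?Q ?R"
      by (intro nat_trans_in_hom[OF nat] Ob)
    have \<mu>: "?\<mu> \<in> Hom C ?R ?S"
      by (rule mult_hom[OF A])
    note ab = comp_in_hom[OF Ob(2-4) b a]
    note GOb = Ob[THEN ob(1)]
    have Gb: "amap G ?b \<in> Hom C (omap G ?P) (omap G ?Q)"
      and Ga: "amap G ?a \<in> Hom C (omap G ?Q) (omap G ?R)"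
      and G\<mu>: "amap G ?\<mu> \<in> Hom C (omap G ?R) (omap G ?S)"
      and M\<mu>: "amap (gfun M 1) ?\<mu> \<in> Hom C (omap (gfun M 1) ?R) (omap (gfun M 1) ?S)"
      using a b \<mu> Ob by (simp_all add: amap_in_hom[OF G] amap_in_hom[OF fM])
    note Gab = comp_in_hom[OF GOb(2-4) Gb Ga]
    have M1: "omap (gfun M 1) ?R \<in> Ob C" "omap (gfun M 1) ?S \<in> Ob C"
      and T: "omap (gfun M (Suc m + n)) A \<in> Ob C" and U: "omap (gfun M (Suc m)) ?N \<in> Ob C"
      by (simp_all add: ob Ob A)
    note \<alpha>R = nat_trans_in_hom[OF \<alpha> Ob(4)] and \<alpha>S = nat_trans_in_hom[OF \<alpha> Ob(5)]
    have \<mu>1: "gmult M 1 (m + n) A \<in> Hom C (omap (gfun M 1) ?S) (omap (gfun M (Suc m + n)) A)"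
      using mult_hom[OF A, of 1 "m + n"] by simp
    have \<mu>2: "gmult M 1 m ?N \<in> Hom C (omap (gfun M 1) ?R) (omap (gfun M (Suc m)) ?N)"
      using mult_hom[OF Ob(1), of 1 m] by simp
    have \<mu>3: "gmult M (Suc m) n A \<in>
        Hom C (omap (gfun M (Suc m)) ?N) (omap (gfun M (Suc m + n)) A)"
      using mult_hom[OF A, of "Suc m" n] by simp
    note \<alpha>Gab = comp_in_hom[OF GOb(2,4) M1(1) Gab \<alpha>R]
    note \<alpha>Ga = comp_in_hom[OF GOb(3,4) M1(1) Ga \<alpha>R]
    have "?\<alpha> (Suc m + n) A = gmult M 1 (m + n) A \<cdot> (\<alpha> ?S \<cdot> amap G (?\<mu> \<cdot> (?a \<cdot> ?b)))"
      using A by (simp add: Suc hcomp_def)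
    also have "amap G (?\<mu> \<cdot> (?a \<cdot> ?b)) = amap G ?\<mu> \<cdot> (amap G ?a \<cdot> amap G ?b)"
      by (simp add: amap_comp[OF G Ob(2,4,5) ab \<mu>] amap_comp[OF G Ob(2-4) b a])
    also have "\<alpha> ?S \<cdot> \<dots> = (\<alpha> ?S \<cdot> amap G ?\<mu>) \<cdot> (amap G ?a \<cdot> amap G ?b)"
      by (rule assoc[OF GOb(2,4,5) M1(2) Gab G\<mu> \<alpha>S])
    \<comment> \<open>Naturality of \<alpha> turns G\<mu>^(m,n) into M_1 \<mu>^(m,n), the form in
      which it meets the associativity law.\<close>
    also have "\<alpha> ?S \<cdot> amap G ?\<mu> = amap (gfun M 1) ?\<mu> \<cdot> \<alpha> ?R"
      by (rule naturality[OF \<alpha> Ob(4,5) \<mu>])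
    also have "\<dots> \<cdot> (amap G ?a \<cdot> amap G ?b) =
        amap (gfun M 1) ?\<mu> \<cdot> (\<alpha> ?R \<cdot> (amap G ?a \<cdot> amap G ?b))"
      by (rule assoc[symmetric, OF GOb(2,4) M1 Gab \<alpha>R M\<mu>])
    also have "gmult M 1 (m + n) A \<cdot> \<dots> =
        (gmult M 1 (m + n) A \<cdot> amap (gfun M 1) ?\<mu>) \<cdot> (\<alpha> ?R \<cdot> (amap G ?a \<cdot> amap G ?b))"
      by (rule assoc[OF GOb(2) M1 T \<alpha>Gab M\<mu> \<mu>1])
    \<comment> \<open>Associativity of M for the grades 1, m, n; afterwards \<mu>^(1,m) is available
      to form \<alpha>^(m+1).\<close>
    also have "gmult M 1 (m + n) A \<cdot> amap (gfun M 1) ?\<mu> = gmult M (Suc m) n A \<cdot> gmult M 1 m ?N"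
      using graded_monadD(4)[OF M A, of 1 m n] by simp
    also have "\<alpha> ?R \<cdot> (amap G ?a \<cdot> amap G ?b) = (\<alpha> ?R \<cdot> amap G ?a) \<cdot> amap G ?b"
      by (rule assoc[OF GOb(2-4) M1(1) Gb Ga \<alpha>R])
    also have "(gmult M (Suc m) n A \<cdot> gmult M 1 m ?N) \<cdot> \<dots> =
        gmult M (Suc m) n A \<cdot> (gmult M 1 m ?N \<cdot> ((\<alpha> ?R \<cdot> amap G ?a) \<cdot> amap G ?b))"
      by (rule assoc[symmetric, OF GOb(2) M1(1) U T _ \<mu>2 \<mu>3])
        (rule comp_in_hom[OF GOb(2,3) M1(1) Gb \<alpha>Ga])
    also have "gmult M 1 m ?N \<cdot> ((\<alpha> ?R \<cdot> amap G ?a) \<cdot> amap G ?b) =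
        (gmult M 1 m ?N \<cdot> (\<alpha> ?R \<cdot> amap G ?a)) \<cdot> amap G ?b"
      by (rule assoc[OF GOb(2,3) M1(1) U Gb \<alpha>Ga \<mu>2])
    \<comment> \<open>The defining recursion, read at the object M_n A instead of A.\<close>
    also have "gmult M 1 m ?N \<cdot> (\<alpha> ?R \<cdot> amap G ?a) = ?\<alpha> (Suc m) ?N"
      using Ob by (simp add: hcomp_def)
    finally show ?case
      using A by (simp add: hcomp_def del: pow_morph.simps)
  qed
  \<comment> \<open>The recursion gives \<mu>^(1,0) \<cdot> \<alpha>M_0 \<cdot> G\<eta>. Naturality
    of \<alpha> at \<eta> moves \<alpha> to the right, leaving \<mu>^(1,0) \<cdot> M_1 \<eta>, which
    is the identity by the right unit law.\<close>
  moreover have "?\<alpha> 1 = \<alpha>"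
  proof (rule extensionalityI)
    show "?\<alpha> 1 \<in> extensional (Ob C)" "\<alpha> \<in> extensional (Ob C)"
      using nat nat_trans_extensional \<alpha> by blast+
    fix A assume A: "A \<in> Ob C"
    have u: "gunit M A \<in> Hom C A (omap (gfun M 0) A)"
      using nat_trans_in_hom[OF unit A] by simp
    have \<mu>: "gmult M 1 0 A \<in> Hom C (omap (gfun M 1) (omap (gfun M 0) A)) (omap (gfun M 1) A)"
      using mult_hom[OF A, of 1 0] by simp
    note \<alpha>A = nat_trans_in_hom[OF \<alpha> A]
    have "?\<alpha> 1 A = gmult M 1 0 A \<cdot> (\<alpha> (omap (gfun M 0) A) \<cdot> amap G (gunit M A))"
      using A by (simp add: hcomp_def)
    also have "\<dots> = gmult M 1 0 A \<cdot> (amap (gfun M 1) (gunit M A) \<cdot> \<alpha> A)"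
      by (simp only: naturality[OF \<alpha> A ob(3)[OF A] u])
    also have "\<dots> = (gmult M 1 0 A \<cdot> amap (gfun M 1) (gunit M A)) \<cdot> \<alpha> A"
      by (intro assoc[OF _ _ _ _ \<alpha>A amap_in_hom[OF fM A _ u] \<mu>] ob A)
    also have "\<dots> = \<alpha> A"
      using graded_monadD(5)[OF M A, of 1] id_comp[OF _ _ \<alpha>A] by (simp add: ob A)
    finally show "?\<alpha> 1 A = \<alpha> A" .
  qed
  ultimately show "gmonad_morphism C (pow_gmonad C G) M ?\<alpha> \<and> ?\<alpha> 1 = \<alpha>"
    using nat by (simp add: gmonad_morphism_pow_gmonad_iff[OF G M] del: pow_morph.simps(2))
  fix \<alpha>' assume "gmonad_morphism C (pow_gmonad C G) M \<alpha>' \<and> \<alpha>' 1 = \<alpha>"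
  then have nat': "nat_trans C (pow_fun G n) (gfun M n) (\<alpha>' n)" and 0: "\<alpha>' 0 = gunit M"
    and mult': "A \<in> Ob C \<Longrightarrow> \<alpha>' (m + n) A =
      gmult M m n A \<cdot> hcomp C (pow_fun G m) (gfun M n) (\<alpha>' m) (\<alpha>' n) A"
    and 1: "\<alpha>' 1 = \<alpha>" for m n A
    by (auto simp: gmonad_morphism_pow_gmonad_iff[OF G M])
  \<comment> \<open>The law at (1, n) forces the recursion at objects of C; at all other arguments
    both families are undefined.\<close>
  have "\<alpha>' n = ?\<alpha> n" for n
  proof (induction n)
    case (Suc n)
    show ?case
    proof (rule extensionalityI)
      show "\<alpha>' (Suc n) \<in> extensional (Ob C)" "?\<alpha> (Suc n) \<in> extensional (Ob C)"
        using nat nat' nat_trans_extensional by blast+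
      fix A assume "A \<in> Ob C"
      then show "\<alpha>' (Suc n) A = ?\<alpha> (Suc n) A"
        using mult'[of A 1 n] 1 Suc by simp
    qed
  qed (simp add: 0)
  then show "\<alpha>' = ?\<alpha>" ..
qed

end

section \<open>Specialisation to the category of sets\<close>

theorem proposition2p16:
  fixes U :: "'u set set"
    and G :: "('u set, 'u set_arrow) endofun"
    and X :: "'u set" and \<gamma> :: "'u set_arrow"
    and M :: "(nat, 'u set, 'u set_arrow) gmonad"
    and \<alpha> :: "'u set \<Rightarrow> 'u set_arrow"
  assumes "endofunctor (set_cat U) G"
    and "coalgebra (set_cat U) G X \<gamma>"
    and "graded_monad (set_cat U) M"
    and "nat_trans (set_cat U) G (gfun M 1) \<alpha>"
  shows "(\<exists>!\<gamma>'. graded_coalgebra (set_cat U) (pow_gmonad (set_cat U) G) X \<gamma>' \<and> \<gamma>' 1 = \<gamma>) \<and>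
         (\<exists>!\<alpha>'. gmonad_morphism (set_cat U) (pow_gmonad (set_cat U) G) M \<alpha>' \<and> \<alpha>' 1 = \<alpha>)"
proof -
  interpret cat "set_cat U"
    by unfold_locales (rule is_category_set_cat)
  show ?thesis
    using ex1_graded_coalgebra ex1_gmonad_morphism assms by blast
qed

end
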